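(* Let $g=dt^2+\sum_{i=1}^r g_i(t)^2h_i$ be the metric associated with an admissible trajectory (as defined in the context). Then, to leading order in $t$ as $t\to+\infty$, $g$ is $$dt^2+t\,\mathsf{h}_\infty,$$ where $\mathsf{h}_\infty$ is a metric on $M_1\times\cdots\times M_r$ in the homothety class of the product Einstein metric $\sum_{i=1}^r\lambda_ih_i$. That is, there is a metric $\mathsf{h}_\infty=\sum_{i=1}^r c_ih_i$ with constants $c_i>0$, equal to a positive constant multiple of $\sum_{i=1}^r\lambda_ih_i$, such that $g_i(t)^2/t\to c_i$ as $t\to+\infty$ for every $i$. (So the metric has asymptotically paraboloid geometry.)
   Context: Let $r\ge1$, let $d_1>1$ be an integer, $M_1=S^{d_1}$ with the round metric $h_1$ of curvature $1$, and let $(M_i,h_i)$, $i=2,\dots,r$, be compact Einstein manifolds with positive Einstein constants. Write $d_i=\dim M_i$ and $\mathrm{Ric}(h_i)=\lambda_ih_i$ with $\lambda_i>0$, so $\lambda_1=d_1-1$. Consider the system of ODEs for functions $X_1,\dots,X_r,Y_1,\dots,Y_r$ of $s$ (prime denotes $d/ds$): $$X_i'=X_i\Big(\sum_{j=1}^r X_j^2-1\Big)+\frac{Y_i^2}{\sqrt{d_i}},\qquad Y_i'=Y_i\Big(\sum_{j=1}^r X_j^2-\frac{X_i}{\sqrt{d_i}}\Big),\qquad i=1,\dots,r.$$ Put $\mathscr{L}=\sum_{i=1}^r(X_i^2+Y_i^2)-1$, $\beta=1/\sqrt{d_1}$, $\hat\beta=+\sqrt{1-\beta^2}$. An admissible trajectory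 is a solution defined for all $s\in\mathbb{R}$, converging as $s\to-\infty$ to the critical point $X_1=\beta$, $Y_1=\hat\beta$, $X_i=Y_i=0$ $(i>1)$, with $Y_i>0$ for all $i$ and $\mathscr{L}<0$ for all $s$. Given an admissible trajectory and a fixed constant $C<0$, the associated metric is $g=dt^2+\sum_{i=1}^r g_i(t)^2h_i$ on $I\times M_1\times\cdots\times M_r$, where $t$ is determined up to an additive constant by $dt=\sqrt{\mathscr{L}/C}\,ds$, $I$ is its range, and $g_i=\sqrt{\mathscr{L}/C}\,\sqrt{d_i\lambda_i}/Y_i$. The range of $t$ is unbounded above, with $t\to+\infty$ as $s\to+\infty$. *)

theory Defs
  imports "HOL-Analysis.Analysis"
begin

section \<open>Calculus in coordinates\<close>

text \<open>
  The dimensions of the factors vary with an index, so local coordinates live in the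
  library's \<^const>\<open>Euclidean_space\<close>: \<open>\<real>\<^sup>n\<close> is the space of all
  \<open>x :: nat \<Rightarrow> real\<close> with \<open>x i = 0\<close> for \<open>i \<ge> n\<close>.
\<close>

type_synonym coord = "nat \<Rightarrow> real"

definition pdiff :: "nat \<Rightarrow> (coord \<Rightarrow> real) \<Rightarrow> coord \<Rightarrow> real" where
  "pdiff a f x = deriv (\<lambda>u. f (x(a := u))) (x a)"

fun iter_pdiff :: "nat list \<Rightarrow> (coord \<Rightarrow> real) \<Rightarrow> coord \<Rightarrow> real" where
  "iter_pdiff [] f = f"
| "iter_pdiff (a # as) f = pdiff a (iter_pdiff as f)"

text \<open>\<open>f\<close> is \<open>C\<^sup>\<infinity>\<close> on the open set \<open>U\<close> of \<open>\<real>\<^sup>n\<close>; its values outside \<open>U\<close> are irrelevant.\<close>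

definition coord_smooth :: "nat \<Rightarrow> coord set \<Rightarrow> (coord \<Rightarrow> real) \<Rightarrow> bool" where
  "coord_smooth n U f \<longleftrightarrow>
     (\<forall>as. set as \<subseteq> {..<n} \<longrightarrow>
        continuous_map (subtopology (Euclidean_space n) U) euclideanreal (iter_pdiff as f) \<and>
        (\<forall>x\<in>U. \<forall>a<n. (\<lambda>u. iter_pdiff as f (x(a := u))) differentiable (at (x a))))"


section \<open>Riemannian manifolds\<close>

text \<open>
  A chart is a pair of an open set of the manifold and a coordinate map on it.  The last
  field gives, for each chart, the components of the metric as functions of the coordinates.
\<close>

type_synonym 'a chart = "'a set \<times> ('a \<Rightarrow> coord)"

record 'a riemannian =
  mtop :: "'a topology"
  mdim :: nat
  atlas :: "'a chart set"
  mcomp :: "'a chart \<Rightarrow> nat \<Rightarrow> nat \<Rightarrow> coord \<Rightarrow> real"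

abbreviation chart_dom :: "'a chart \<Rightarrow> 'a set" where "chart_dom c \<equiv> fst c"
abbreviation chart_map :: "'a chart \<Rightarrow> 'a \<Rightarrow> coord" where "chart_map c \<equiv> snd c"

definition chart_inv :: "'a chart \<Rightarrow> coord \<Rightarrow> 'a" where
  "chart_inv c = inv_into (chart_dom c) (chart_map c)"

definition transition :: "'a chart \<Rightarrow> 'a chart \<Rightarrow> coord \<Rightarrow> coord" where
  "transition c c' x = chart_map c' (chart_inv c x)"

definition riemannian_manifold :: "'a riemannian \<Rightarrow> bool" where
  "riemannian_manifold M \<longleftrightarrow>
     topspace (mtop M) \<noteq> {} \<and> Hausdorff_space (mtop M) \<and> second_countable (mtop M) \<and>
     (\<Union>c\<in>atlas M. chart_dom c) = topspace (mtop M) \<and>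
     (\<forall>c\<in>atlas M.
        openin (mtop M) (chart_dom c) \<and>
        openin (Euclidean_space (mdim M)) (chart_map c ` chart_dom c) \<and>
        homeomorphic_map (subtopology (mtop M) (chart_dom c))
          (subtopology (Euclidean_space (mdim M)) (chart_map c ` chart_dom c)) (chart_map c)) \<and>
     (\<forall>c\<in>atlas M. \<forall>c'\<in>atlas M. \<forall>k<mdim M.
        coord_smooth (mdim M) (chart_map c ` (chart_dom c \<inter> chart_dom c'))
          (\<lambda>x. transition c c' x k)) \<and>
     (\<forall>c\<in>atlas M. \<forall>a<mdim M. \<forall>b<mdim M.
        coord_smooth (mdim M) (chart_map c ` chart_dom c) (mcomp M c a b) \<and>
        (\<forall>x \<in> chart_map c ` chart_dom c. mcomp M c a b x = mcomp M c b a x)) \<and>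
     (\<forall>c\<in>atlas M. \<forall>x \<in> chart_map c ` chart_dom c. \<forall>v::coord.
        (\<exists>a<mdim M. v a \<noteq> 0) \<longrightarrow>
        (\<Sum>a<mdim M. \<Sum>b<mdim M. mcomp M c a b x * v a * v b) > 0) \<and>
     (\<forall>c\<in>atlas M. \<forall>c'\<in>atlas M. \<forall>x \<in> chart_map c ` (chart_dom c \<inter> chart_dom c').
        \<forall>a<mdim M. \<forall>b<mdim M.
        mcomp M c a b x =
          (\<Sum>k<mdim M. \<Sum>l<mdim M.
             pdiff a (\<lambda>y. transition c c' y k) x * pdiff b (\<lambda>y. transition c c' y l) x *
             mcomp M c' k l (transition c c' x)))"

text \<open>Only the entries with both indices below \<open>n\<close> are determined.\<close>

definition mat_inverse :: "nat \<Rightarrow> (nat \<Rightarrow> nat \<Rightarrow> real) \<Rightarrow> nat \<Rightarrow> nat \<Rightarrow> real" where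
  "mat_inverse n A =
     (SOME B. \<forall>a<n. \<forall>b<n. (\<Sum>c<n. B a c * A c b) = (if a = b then 1 else 0))"

text \<open>\<open>christoffel M ch c a b\<close> is \<open>\<Gamma>\<^sup>c\<^sub>a\<^sub>b\<close> of the Levi-Civita connection in the chart \<open>ch\<close>.\<close>

definition christoffel ::
    "'a riemannian \<Rightarrow> 'a chart \<Rightarrow> nat \<Rightarrow> nat \<Rightarrow> nat \<Rightarrow> coord \<Rightarrow> real" where
  "christoffel M ch c a b x =
     (\<Sum>e<mdim M. mat_inverse (mdim M) (\<lambda>k l. mcomp M ch k l x) c e *
        (pdiff a (mcomp M ch b e) x + pdiff b (mcomp M ch a e) x - pdiff e (mcomp M ch a b) x)) / 2"

text \<open>The sign convention makes the Ricci curvature of round spheres positive.\<close>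

definition ricci :: "'a riemannian \<Rightarrow> 'a chart \<Rightarrow> nat \<Rightarrow> nat \<Rightarrow> coord \<Rightarrow> real" where
  "ricci M ch a b x =
     (\<Sum>c<mdim M. pdiff c (christoffel M ch c a b) x - pdiff b (christoffel M ch c a c) x +
        (\<Sum>e<mdim M. christoffel M ch c c e x * christoffel M ch e a b x -
                     christoffel M ch c b e x * christoffel M ch e a c x))"

text \<open>Dimension \<open>0\<close>, where the equation would be void for every constant, is excluded.\<close>

definition compact_einstein :: "'a riemannian \<Rightarrow> real \<Rightarrow> bool" where
  "compact_einstein M lam \<longleftrightarrow>
     riemannian_manifold M \<and> compact_space (mtop M) \<and> mdim M > 0 \<and>
     (\<forall>ch\<in>atlas M. \<forall>x \<in> chart_map ch ` chart_dom ch. \<forall>a<mdim M. \<forall>b<mdim M.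
        ricci M ch a b x = lam * mcomp M ch a b x)"

text \<open>
  The sphere \<open>S\<^sup>n\<close> with the metric of constant curvature \<open>1\<close>, up to isometry: \<open>F\<close> identifies
  the manifold with the unit sphere of \<open>\<real>\<^sup>n\<^sup>+\<^sup>1\<close> and the metric is the pullback of the
  Euclidean one.
\<close>

definition round_unit_sphere :: "nat \<Rightarrow> 'a riemannian \<Rightarrow> bool" where
  "round_unit_sphere n M \<longleftrightarrow>
     riemannian_manifold M \<and> mdim M = n \<and>
     (\<exists>F. homeomorphic_map (mtop M) (nsphere n) F \<and>
        (\<forall>ch\<in>atlas M.
           (\<forall>k\<le>n. coord_smooth n (chart_map ch ` chart_dom ch) (\<lambda>x. F (chart_inv ch x) k)) \<and>
           (\<forall>x \<in> chart_map ch ` chart_dom ch. \<forall>a<n. \<forall>b<n.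
              mcomp M ch a b x =
                (\<Sum>k\<le>n. pdiff a (\<lambda>y. F (chart_inv ch y) k) x *
                         pdiff b (\<lambda>y. F (chart_inv ch y) k) x))))"


section \<open>Metrics on products\<close>

text \<open>
  A point of \<open>M\<^sub>1 \<times> \<dots> \<times> M\<^sub>r\<close> is given by \<open>p\<close>, a product chart around it by \<open>ch\<close>, and a tangent
  vector there by its components \<open>v i a\<close> (\<open>a\<close>-th component of the part tangent to \<open>M\<^sub>i\<close>).
\<close>

definition product_chart_at ::
    "nat \<Rightarrow> (nat \<Rightarrow> 'a riemannian) \<Rightarrow> (nat \<Rightarrow> 'a chart) \<Rightarrow> (nat \<Rightarrow> 'a) \<Rightarrow> bool" where
  "product_chart_at r M ch p \<longleftrightarrow> (\<forall>i\<in>{1..r}. ch i \<in> atlas (M i) \<and> p i \<in> chart_dom (ch i))"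

definition metric_form :: "'a riemannian \<Rightarrow> 'a chart \<Rightarrow> 'a \<Rightarrow> coord \<Rightarrow> coord \<Rightarrow> real" where
  "metric_form M ch p v w =
     (\<Sum>a<mdim M. \<Sum>b<mdim M. mcomp M ch a b (chart_map ch p) * v a * w b)"

text \<open>The metric \<open>\<Sum>\<^sub>i k\<^sub>i h\<^sub>i\<close>.\<close>

definition product_metric ::
    "nat \<Rightarrow> (nat \<Rightarrow> 'a riemannian) \<Rightarrow> (nat \<Rightarrow> real) \<Rightarrow> (nat \<Rightarrow> 'a chart) \<Rightarrow> (nat \<Rightarrow> 'a) \<Rightarrow>
     (nat \<Rightarrow> coord) \<Rightarrow> (nat \<Rightarrow> coord) \<Rightarrow> real" where
  "product_metric r M k ch p v w =
     (\<Sum>i=1..r. k i * metric_form (M i) (ch i) (p i) (v i) (w i))"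

text \<open>
  The metric \<open>dt\<^sup>2 + \<Sum>\<^sub>i g\<^sub>i(t)\<^sup>2 h\<^sub>i\<close> at \<open>(t, p)\<close>; a tangent vector is a pair of its
  \<open>\<partial>/\<partial>t\<close>-component and its part tangent to the product.
\<close>

definition warped_metric ::
    "nat \<Rightarrow> (nat \<Rightarrow> 'a riemannian) \<Rightarrow> (nat \<Rightarrow> real \<Rightarrow> real) \<Rightarrow> (nat \<Rightarrow> 'a chart) \<Rightarrow>
     real \<Rightarrow> (nat \<Rightarrow> 'a) \<Rightarrow> real \<times> (nat \<Rightarrow> coord) \<Rightarrow> real \<times> (nat \<Rightarrow> coord) \<Rightarrow> real" where
  "warped_metric r M g ch t p V W =
     fst V * fst W + product_metric r M (\<lambda>i. (g i t)\<^sup>2) ch p (snd V) (snd W)"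


section \<open>The soliton system\<close>

definition Lyap :: "nat \<Rightarrow> (nat \<Rightarrow> real \<Rightarrow> real) \<Rightarrow> (nat \<Rightarrow> real \<Rightarrow> real) \<Rightarrow> real \<Rightarrow> real" where
  "Lyap r X Y s = (\<Sum>i=1..r. (X i s)\<^sup>2 + (Y i s)\<^sup>2) - 1"

definition soliton_ode ::
    "nat \<Rightarrow> (nat \<Rightarrow> nat) \<Rightarrow> (nat \<Rightarrow> real \<Rightarrow> real) \<Rightarrow> (nat \<Rightarrow> real \<Rightarrow> real) \<Rightarrow> bool" where
  "soliton_ode r d X Y \<longleftrightarrow>
     (\<forall>i\<in>{1..r}. \<forall>s.
        (X i has_real_derivative
           (X i s * ((\<Sum>j=1..r. (X j s)\<^sup>2) - 1) + (Y i s)\<^sup>2 / sqrt (real (d i)))) (at s) \<and>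
        (Y i has_real_derivative
           (Y i s * ((\<Sum>j=1..r. (X j s)\<^sup>2) - X i s / sqrt (real (d i))))) (at s))"

definition admissible_trajectory ::
    "nat \<Rightarrow> (nat \<Rightarrow> nat) \<Rightarrow> (nat \<Rightarrow> real \<Rightarrow> real) \<Rightarrow> (nat \<Rightarrow> real \<Rightarrow> real) \<Rightarrow> bool" where
  "admissible_trajectory r d X Y \<longleftrightarrow>
     soliton_ode r d X Y \<and>
     (let \<beta> = 1 / sqrt (real (d 1)) in
        (X 1 \<longlongrightarrow> \<beta>) at_bot \<and> (Y 1 \<longlongrightarrow> sqrt (1 - \<beta>\<^sup>2)) at_bot) \<and>
     (\<forall>i\<in>{2..r}. (X i \<longlongrightarrow> 0) at_bot \<and> (Y i \<longlongrightarrow> 0) at_bot) \<and>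
     (\<forall>i\<in>{1..r}. \<forall>s. Y i s > 0) \<and>
     (\<forall>s. Lyap r X Y s < 0)"

text \<open>
  \<open>t\<close> is the arclength coordinate as a function of \<open>s\<close>, and the \<open>g\<^sub>i\<close> are functions of
  arclength; they are prescribed on the interval \<open>I = range t\<close> only.
\<close>

definition associated_warping ::
    "nat \<Rightarrow> (nat \<Rightarrow> nat) \<Rightarrow> (nat \<Rightarrow> real) \<Rightarrow> real \<Rightarrow> (nat \<Rightarrow> real \<Rightarrow> real) \<Rightarrow>
     (nat \<Rightarrow> real \<Rightarrow> real) \<Rightarrow> (real \<Rightarrow> real) \<Rightarrow> (nat \<Rightarrow> real \<Rightarrow> real) \<Rightarrow> bool" where
  "associated_warping r d lam C X Y t g \<longleftrightarrow>
     (\<forall>s. (t has_real_derivative sqrt (Lyap r X Y s / C)) (at s)) \<and>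
     (\<forall>i\<in>{1..r}. \<forall>s.
        g i (t s) = sqrt (Lyap r X Y s / C) * sqrt (real (d i) * lam i) / Y i s)"

end

theory Submission
  imports Defs "HOL-Real_Asymp.Real_Asymp"
begin

text \<open>
  Along the flow \<open>N = -\<L>\<close> satisfies \<open>N' = 2 S N\<close> with \<open>S = \<Sum> X\<^sub>j\<^sup>2\<close>, so \<open>N\<close> increases to a limit \<open>l > 0\<close>
  and, \<open>S'\<close> being bounded, \<open>S \<rightarrow> 0\<close>. The squared warping functions are multiples of \<open>W\<^sub>i = N / Y\<^sub>i\<^sup>2\<close>,
  and \<open>W\<^sub>i' = 2 X\<^sub>i W\<^sub>i / \<surd>d\<^sub>i\<close>. The product \<open>X\<^sub>i W\<^sub>i\<close> solves a linear equation which tends to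
  \<open>z' = -z + l / \<surd>d\<^sub>i\<close>, hence \<open>X\<^sub>i W\<^sub>i \<rightarrow> l / \<surd>d\<^sub>i\<close>. Since \<open>t'\<close> has a positive limit,
  l'Hopital's rule gives the limit of \<open>g\<^sub>i\<^sup>2 / t\<close>, which is proportional to \<open>\<lambda>\<^sub>i\<close>.
\<close>

section \<open>Limits of real functions at infinity\<close>

text \<open>The limit is the supremum of the range. The bound \<open>f s \<le> l\<close> is exported
  because it makes the limit of \<open>N\<close> positive.\<close>

lemma monotone_bounded_tendsto_at_top:
  fixes f :: "real \<Rightarrow> real"
  assumes "mono f" and "\<And>s. f s \<le> B"
  obtains l where "(f \<longlongrightarrow> l) at_top" and "\<And>s. f s \<le> l"
proof
  have bdd: "bdd_above (range f)"
    using assms(2) by (auto simp: bdd_above_def)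
  show le: "f s \<le> (SUP s. f s)" for s
    by (rule cSUP_upper[OF _ bdd]) simp
  show "(f \<longlongrightarrow> (SUP s. f s)) at_top"
  proof (rule increasing_tendsto)
    show "\<forall>\<^sub>F s in at_top. f s \<le> (SUP s. f s)"
      by (simp add: le)
  next
    fix x
    assume "x < (SUP s. f s)"
    then obtain s where "x < f s"
      by (auto simp: less_cSUP_iff[OF _ bdd])
    then show "\<forall>\<^sub>F s in at_top. x < f s"
      unfolding eventually_at_top_linorder by (metis assms(1) less_le_trans monoD)
  qed
qed

text \<open>Barbalat's lemma: the average of \<open>f'\<close> over \<open>[s, s + \<delta>]\<close> tends to \<open>0\<close>, and \<open>f'\<close> drops
  by at most \<open>K \<delta>\<close> on this interval.\<close>

lemma barbalat:
  fixes f f' f'' :: "real \<Rightarrow> real"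
  assumes f: "\<And>s. (f has_real_derivative f' s) (at s)"
    and f': "\<And>s. (f' has_real_derivative f'' s) (at s)"
    and bound: "\<And>s. - K \<le> f'' s"
    and nonneg: "\<And>s. 0 \<le> f' s"
    and lim: "(f \<longlongrightarrow> l) at_top"
  shows "(f' \<longlongrightarrow> 0) at_top"
proof (rule decreasing_tendsto)
  show "\<forall>\<^sub>F s in at_top. 0 \<le> f' s"
    by (simp add: nonneg)
next
  fix e :: real
  assume e: "0 < e"
  \<comment> \<open>With this width the drop is at most \<open>e / 2\<close>, and the other half of
    \<open>e\<close> is left for the average. The summand \<open>1\<close> keeps the denominator
    positive when \<open>K = 0\<close>.\<close>
  define \<delta> where "\<delta> = e / (2 * (\<bar>K\<bar> + 1))"
  have \<delta>: "\<delta> > 0"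
    using e by (simp add: \<delta>_def)
  have "\<bar>K\<bar> * \<delta> \<le> (\<bar>K\<bar> + 1) * \<delta>"
    using \<delta> by (simp add: mult_right_mono)
  also have "\<dots> = e / 2"
    by (simp add: \<delta>_def field_simps)
  finally have K\<delta>: "\<bar>K\<bar> * \<delta> \<le> e / 2" .
  have shift: "((\<lambda>s. f (s + \<delta>)) \<longlongrightarrow> l) at_top"
    by (rule filterlim_compose[OF lim]) real_asymp
  have "((\<lambda>s. (f (s + \<delta>) - f s) / \<delta>) \<longlongrightarrow> (l - l) / \<delta>) at_top"
    using \<delta> by (intro tendsto_intros shift lim) simp
  then have "\<forall>\<^sub>F s in at_top. (f (s + \<delta>) - f s) / \<delta> < e / 2"
    using e by (intro order_tendstoD(2)) auto
  then show "\<forall>\<^sub>F s in at_top. f' s < e"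
  proof eventually_elim
    case (elim s)
    obtain \<xi> where \<xi>: "s < \<xi>" "\<xi> < s + \<delta>" "f (s + \<delta>) - f s = (s + \<delta> - s) * f' \<xi>"
      using MVT2[of s "s + \<delta>" f f'] \<delta> f by auto
    obtain \<eta> where \<eta>: "f' \<xi> - f' s = (\<xi> - s) * f'' \<eta>"
      using MVT2[of s \<xi> f' f''] \<xi>(1) f' by auto
    have "- (\<bar>K\<bar> * \<delta>) \<le> - (\<bar>K\<bar> * (\<xi> - s))"
      using \<xi> by (simp add: mult_left_mono)
    also have "\<dots> \<le> (\<xi> - s) * f'' \<eta>"
      using \<xi>(1) mult_left_mono[of "- \<bar>K\<bar>" "f'' \<eta>" "\<xi> - s"] bound[of \<eta>]
      by (simp add: mult.commute)
    finally have "f' s \<le> f' \<xi> + \<bar>K\<bar> * \<delta>"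
      using \<eta> by linarith
    then show ?case
      using elim \<xi>(3) \<delta> K\<delta> by simp
  qed
qed

text \<open>The mean value theorem puts \<open>f\<close> above a line of slope \<open>k\<close>. It
  serves both for arclength and for a logarithm in \<open>XW_limit\<close>.\<close>

lemma filterlim_at_top_of_derivative_ge:
  fixes f :: "real \<Rightarrow> real"
  assumes f: "\<And>s. s \<ge> a \<Longrightarrow> (f has_real_derivative f' s) (at s)"
    and ge: "\<And>s. s \<ge> a \<Longrightarrow> k \<le> f' s" and "k > 0"
  shows "filterlim f at_top at_top"
proof (rule filterlim_at_top_mono)
  show "filterlim (\<lambda>s. k * (s - a) + f a) at_top at_top"
    using \<open>k > 0\<close> by real_asymp
  show "\<forall>\<^sub>F s in at_top. k * (s - a) + f a \<le> f s"
    using eventually_gt_at_top[of a]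
  proof eventually_elim
    case (elim s)
    obtain \<xi> where "a < \<xi>" "f s - f a = (s - a) * f' \<xi>"
      using MVT2[of a s f f'] elim f by auto
    moreover have "k * (s - a) \<le> (s - a) * f' \<xi>"
      using ge[of \<xi>] \<open>a < \<xi>\<close> elim by (simp add: mult.commute mult_left_mono)
    ultimately show ?case
      by linarith
  qed
qed

text \<open>By the intermediate value theorem every value beyond \<open>t a\<close> is
  \<open>t s\<close> for some \<open>s \<ge> a\<close>, so a property of \<open>t s\<close> for all
  large \<open>s\<close> holds at all large arguments. This turns limits in \<open>s\<close> into
  limits in arclength.\<close>

lemma tendsto_at_top_of_reparametrization:
  fixes t :: "real \<Rightarrow> real"
  assumes cont: "\<And>s. isCont t s" and lim: "filterlim t at_top at_top"
    and comp: "((\<lambda>s. f (t s)) \<longlongrightarrow> l) at_top"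
  shows "(f \<longlongrightarrow> l) at_top"
proof -
  have "at_top \<le> filtermap t at_top"
  proof (rule filter_leI)
    fix P
    assume "eventually P (filtermap t at_top)"
    then obtain a where a: "\<And>s. s \<ge> a \<Longrightarrow> P (t s)"
      by (auto simp: eventually_filtermap eventually_at_top_linorder)
    show "eventually P at_top"
      using eventually_ge_at_top[of "t a"]
    proof eventually_elim
      case (elim \<tau>)
      obtain b where "b \<ge> a" "\<tau> \<le> t b"
        using lim eventually_ge_at_top[of a]
        unfolding filterlim_at_top
        by (metis (mono_tags, lifting) eventually_at_top_linorder linear)
      then obtain s where "a \<le> s" "t s = \<tau>"
        using IVT[of t a \<tau> b] elim cont by auto
      then show ?case
        using a by blast
    qed
  qed
  then show ?thesis
    using comp unfolding filterlim_def filtermap_filtermap[symmetric, of f t]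
    by (metis (no_types, lifting) filtermap_filtermap filtermap_mono order_trans)
qed

section \<open>The soliton flow and a priori bounds\<close>

locale soliton_trajectory =
  fixes r :: nat and d :: "nat \<Rightarrow> nat" and X Y :: "nat \<Rightarrow> real \<Rightarrow> real"
  assumes ode: "soliton_ode r d X Y"
    and Y_pos: "\<And>i s. i \<in> {1..r} \<Longrightarrow> 0 < Y i s"
    and Lyap_neg: "\<And>s. Lyap r X Y s < 0"
begin

definition S :: "real \<Rightarrow> real" where
  "S s = (\<Sum>j=1..r. (X j s)\<^sup>2)"

text \<open>The sign is reversed so that logarithms and square roots can be taken.\<close>

definition N :: "real \<Rightarrow> real" where
  "N s = - Lyap r X Y s"

definition W :: "nat \<Rightarrow> real \<Rightarrow> real" where
  "W i s = N s / (Y i s)\<^sup>2"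

lemma X_deriv:
  "i \<in> {1..r} \<Longrightarrow>
    (X i has_real_derivative (X i s * (S s - 1) + (Y i s)\<^sup>2 / sqrt (real (d i)))) (at s)"
  using ode unfolding soliton_ode_def S_def by blast

lemma Y_deriv:
  "i \<in> {1..r} \<Longrightarrow>
    (Y i has_real_derivative (Y i s * (S s - X i s / sqrt (real (d i))))) (at s)"
  using ode unfolding soliton_ode_def S_def by blast

lemma N_pos: "0 < N s"
  using Lyap_neg[of s] by (simp add: N_def)

lemma N_eq: "N s = 1 - S s - (\<Sum>i=1..r. (Y i s)\<^sup>2)"
  by (simp add: N_def Lyap_def S_def sum.distrib)

lemma S_nonneg: "0 \<le> S s"
  by (simp add: S_def sum_nonneg)

lemma S_le_1: "S s \<le> 1"
  using N_pos[of s] sum_nonneg[of "{1..r}" "\<lambda>i. (Y i s)\<^sup>2"] unfolding N_eq by simp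

lemma N_le_1: "N s \<le> 1"
  using S_nonneg[of s] sum_nonneg[of "{1..r}" "\<lambda>i. (Y i s)\<^sup>2"] unfolding N_eq by simp

lemma Y_sq_le_1:
  assumes "i \<in> {1..r}"
  shows "(Y i s)\<^sup>2 \<le> 1"
proof -
  have "(Y i s)\<^sup>2 \<le> (\<Sum>i=1..r. (Y i s)\<^sup>2)"
    using assms by (intro member_le_sum) auto
  then show ?thesis
    using N_pos[of s] S_nonneg[of s] unfolding N_eq by linarith
qed

lemma X_sq_le_S: "i \<in> {1..r} \<Longrightarrow> (X i s)\<^sup>2 \<le> S s"
  unfolding S_def by (intro member_le_sum) auto

section \<open>Monotonicity of \<open>N\<close> and decay of \<open>S\<close>\<close>

lemma S_deriv:
  "(S has_real_derivative
     (2 * S s * (S s - 1) + 2 * (\<Sum>i=1..r. X i s * (Y i s)\<^sup>2 / sqrt (real (d i))))) (at s)"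
proof -
  have "((\<lambda>s. \<Sum>i=1..r. (X i s)\<^sup>2) has_real_derivative
      (\<Sum>i=1..r. 2 * X i s * (X i s * (S s - 1) + (Y i s)\<^sup>2 / sqrt (real (d i))))) (at s)"
    by (rule DERIV_sum) (auto intro!: derivative_eq_intros X_deriv)
  moreover have "(\<Sum>i=1..r. 2 * X i s * (X i s * (S s - 1) + (Y i s)\<^sup>2 / sqrt (real (d i)))) =
      2 * S s * (S s - 1) + 2 * (\<Sum>i=1..r. X i s * (Y i s)\<^sup>2 / sqrt (real (d i)))"
    unfolding S_def[of s]
    by (simp add: sum_distrib_left sum_distrib_right sum.distrib[symmetric] algebra_simps power2_eq_square)
  ultimately show ?thesis
    unfolding S_def[abs_def] by simp
qed

text \<open>The mixed terms \<open>X i s * (Y i s)\<^sup>2 / sqrt (real (d i))\<close> from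
  \<open>S\<close> and from the sum of the \<open>(Y i s)\<^sup>2\<close> cancel, and
  \<open>N s\<close> factors out of the rest.\<close>

lemma N_deriv: "(N has_real_derivative (2 * S s * N s)) (at s)"
proof -
  have "((\<lambda>s. \<Sum>i=1..r. (Y i s)\<^sup>2) has_real_derivative
      (\<Sum>i=1..r. 2 * Y i s * (Y i s * (S s - X i s / sqrt (real (d i)))))) (at s)"
    by (rule DERIV_sum) (auto intro!: derivative_eq_intros Y_deriv)
  moreover have "(\<Sum>i=1..r. 2 * Y i s * (Y i s * (S s - X i s / sqrt (real (d i))))) =
      2 * S s * (\<Sum>i=1..r. (Y i s)\<^sup>2) - 2 * (\<Sum>i=1..r. X i s * (Y i s)\<^sup>2 / sqrt (real (d i)))"
    by (simp add: sum_distrib_left sum_subtractf[symmetric] algebra_simps power2_eq_square)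
  ultimately have Ysum: "((\<lambda>s. \<Sum>i=1..r. (Y i s)\<^sup>2) has_real_derivative
      2 * S s * (\<Sum>i=1..r. (Y i s)\<^sup>2) - 2 * (\<Sum>i=1..r. X i s * (Y i s)\<^sup>2 / sqrt (real (d i))))
      (at s)"
    by simp
  have "((\<lambda>s. 1 - S s - (\<Sum>i=1..r. (Y i s)\<^sup>2)) has_real_derivative 2 * S s * N s) (at s)"
    by (rule derivative_eq_intros S_deriv Ysum refl)+ (simp add: N_eq algebra_simps)
  then show ?thesis
    by (simp add: N_eq[abs_def])
qed

lemma N_mono: "mono N"
proof (rule monoI)
  fix a b :: real
  assume "a \<le> b"
  then show "N a \<le> N b"
    by (rule DERIV_nonneg_imp_nondecreasing) (use N_deriv S_nonneg N_pos in \<open>fastforce simp: less_imp_le\<close>)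
qed

lemma N_limit:
  obtains l where "0 < l" and "(N \<longlongrightarrow> l) at_top"
  by (metis monotone_bounded_tendsto_at_top[OF N_mono N_le_1] N_pos less_le_trans)

text \<open>Barbalat's lemma applies to \<open>ln (N s) / 2\<close>, an antiderivative of
  \<open>S\<close> that converges because the limit of \<open>N\<close> is positive.\<close>

lemma S_limit: "(S \<longlongrightarrow> 0) at_top"
proof -
  obtain l where l: "0 < l" "(N \<longlongrightarrow> l) at_top"
    using N_limit .
  show ?thesis
  proof (rule barbalat)
    show "((\<lambda>s. ln (N s) / 2) has_real_derivative S s) (at s)" for s
      using N_pos[of s] by (auto intro!: derivative_eq_intros N_deriv)
    show "((\<lambda>s. ln (N s) / 2) \<longlongrightarrow> ln l / 2) at_top"
      using l by (intro tendsto_intros) auto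
    \<comment> \<open>A crude bound: \<open>S s * (1 - S s)\<close> is at most \<open>1\<close>, and
      each of the \<open>r\<close> mixed terms is at least \<open>- 1\<close>.\<close>
    show "- (2 + 2 * real r) \<le>
        2 * S s * (S s - 1) + 2 * (\<Sum>i=1..r. X i s * (Y i s)\<^sup>2 / sqrt (real (d i)))" for s
    proof -
      have "- 1 \<le> X i s * (Y i s)\<^sup>2 / sqrt (real (d i))" if i: "i \<in> {1..r}" for i
      proof -
        have "\<bar>X i s\<bar> \<le> 1"
          using order_trans[OF X_sq_le_S[OF i] S_le_1, of s] by (simp add: abs_square_le_1)
        \<comment> \<open>For \<open>d i = 0\<close> the quotient is \<open>0\<close> by the
          convention for division.\<close>
        moreover have "1 / sqrt (real (d i)) \<le> 1"
          by (cases "d i = 0") auto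
        ultimately have "\<bar>X i s\<bar> * (Y i s)\<^sup>2 * (1 / sqrt (real (d i))) \<le> 1"
          using Y_sq_le_1[OF i, of s] by (intro mult_le_one) auto
        then have "\<bar>X i s * (Y i s)\<^sup>2 / sqrt (real (d i))\<bar> \<le> 1"
          by (simp add: abs_mult)
        then show ?thesis
          by linarith
      qed
      then have "(\<Sum>i=1..r. - 1) \<le> (\<Sum>i=1..r. X i s * (Y i s)\<^sup>2 / sqrt (real (d i)))"
        by (rule sum_mono)
      moreover have "S s * (1 - S s) \<le> 1"
        using S_nonneg[of s] S_le_1[of s] by (intro mult_le_one) auto
      ultimately show ?thesis
        by (simp add: algebra_simps)
    qed
  qed (rule S_deriv S_nonneg)+
qed

lemma X_limit:
  assumes "i \<in> {1..r}"
  shows "(X i \<longlongrightarrow> 0) at_top"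
proof -
  have "((\<lambda>s. (X i s)\<^sup>2) \<longlongrightarrow> 0) at_top"
    by (rule tendsto_sandwich[OF _ _ tendsto_const S_limit]) (auto simp: X_sq_le_S[OF assms])
  then show ?thesis
    by simp
qed

section \<open>Growth of the squared warping functions in \<open>s\<close>\<close>

text \<open>The logarithmic derivatives of \<open>N\<close> and \<open>(Y i)\<^sup>2\<close> share
  the term \<open>2 * S s\<close>, which cancels in the quotient.\<close>

lemma W_deriv:
  assumes "i \<in> {1..r}"
  shows "(W i has_real_derivative (2 * (X i s * W i s) / sqrt (real (d i)))) (at s)"
  unfolding W_def[abs_def] using Y_pos[OF assms, of s]
  by (auto intro!: derivative_eq_intros N_deriv Y_deriv assms)
     (simp add: W_def field_simps power2_eq_square power4_eq_xxxx)

text \<open>L'Hopital's rule is applied to \<open>X W = u / v\<close>, where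
  \<open>u = e\<^sup>s X / \<surd>N\<close> comes from the integrating factor \<open>e\<^sup>s / \<surd>N\<close> of the equation for \<open>X\<close>.\<close>

lemma XW_limit:
  assumes i: "i \<in> {1..r}" and l: "(N \<longlongrightarrow> l) at_top"
  shows "((\<lambda>s. X i s * W i s) \<longlongrightarrow> l / sqrt (real (d i))) at_top"
proof -
  define a where "a = 1 / sqrt (real (d i))"
  define R where "R s = sqrt (N s)" for s
  define u where "u s = X i s * exp s / R s" for s
  define v where "v s = exp s / (W i s * R s)" for s
  \<comment> \<open>The logarithmic derivative of \<open>v\<close>: the three terms come from
    \<open>exp\<close>, \<open>W i\<close> and \<open>R\<close>.\<close>
  define q where "q s = 1 - 2 * a * X i s - S s" for s
  have W_pos: "0 < W i s" for s
    using N_pos[of s] Y_pos[OF i, of s] by (simp add: W_def)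
  have R_pos: "0 < R s" for s
    using N_pos[of s] by (simp add: R_def)
  have R_deriv: "(R has_real_derivative S s * R s) (at s)" for s
    unfolding R_def[abs_def] using N_pos[of s]
    by (auto intro!: derivative_eq_intros N_deriv) (simp add: field_simps)
  have u_deriv: "(u has_real_derivative a * (Y i s)\<^sup>2 * exp s / R s) (at s)" for s
    unfolding u_def[abs_def] using R_pos[of s]
    by (auto intro!: derivative_eq_intros X_deriv[OF i] R_deriv)
       (simp add: a_def field_simps)
  have v_deriv: "(v has_real_derivative v s * q s) (at s)" for s
    unfolding v_def[abs_def] using R_pos[of s] W_pos[of s]
    by (auto intro!: derivative_eq_intros W_deriv[OF i] R_deriv)
       (simp add: a_def q_def field_simps)
  have v_pos: "0 < v s" for s
    using R_pos[of s] W_pos[of s] by (simp add: v_def)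
  have q: "(q \<longlongrightarrow> 1) at_top"
    unfolding q_def[abs_def] by (auto intro!: tendsto_eq_intros X_limit[OF i] S_limit)
  have q_ev: "\<forall>\<^sub>F s in at_top. 1 / 2 < q s"
    using q by (rule order_tendstoD) simp
  have v_lim: "filterlim v at_top at_top"
  proof -
    obtain b where b: "\<And>s. s \<ge> b \<Longrightarrow> 1 / 2 < q s"
      using q_ev by (auto simp: eventually_at_top_linorder)
    \<comment> \<open>Passing to the logarithm replaces the derivative \<open>v s * q s\<close> by
      \<open>q s\<close>, which is eventually above \<open>1 / 2\<close>.\<close>
    have "filterlim (\<lambda>s. ln (v s)) at_top at_top"
    proof (rule filterlim_at_top_of_derivative_ge)
      show "((\<lambda>s. ln (v s)) has_real_derivative q s) (at s)" for s
        using v_pos[of s] by (auto intro!: derivative_eq_intros v_deriv)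
      show "1 / 2 \<le> q s" if "s \<ge> b" for s
        using b[OF that] by simp
    qed simp
    then have "filterlim (\<lambda>s. exp (ln (v s))) at_top at_top"
      by (rule filterlim_compose[OF exp_at_top])
    then show ?thesis
      by (simp add: v_pos)
  qed
  have "((\<lambda>s. u s / v s) \<longlongrightarrow> l * a) at_top"
  proof (rule lhospital_at_top_at_top[OF v_lim])
    show "\<forall>\<^sub>F s in at_top. v s * q s \<noteq> 0"
      using q_ev by eventually_elim (use v_pos in \<open>auto simp: less_imp_neq[symmetric]\<close>)
    \<comment> \<open>The factors \<open>exp s\<close> and \<open>R s\<close> drop out, and
      \<open>(Y i s)\<^sup>2 * W i s = N s\<close>.\<close>
    have eq: "a * (Y i s)\<^sup>2 * exp s / R s / (v s * q s) = N s * a / q s" for s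
      using N_pos[of s] R_pos[of s] Y_pos[OF i, of s] by (simp add: v_def W_def field_simps)
    show "((\<lambda>s. a * (Y i s)\<^sup>2 * exp s / R s / (v s * q s)) \<longlongrightarrow> l * a) at_top"
      unfolding eq by (auto intro!: tendsto_eq_intros l q)
  qed (simp_all add: u_deriv v_deriv)
  moreover have "u s / v s = X i s * W i s" for s
    using R_pos[of s] W_pos[of s] by (simp add: u_def v_def field_simps)
  ultimately show ?thesis
    by (simp add: a_def)
qed

section \<open>Passage to arclength\<close>

text \<open>As \<open>N\<close> is nondecreasing, the speed of \<open>t\<close> for
  \<open>s \<ge> 0\<close> is at least its positive value at \<open>0\<close>.\<close>

lemma arclength_filterlim:
  assumes "C < 0"
    and "\<And>s. (t has_real_derivative sqrt (Lyap r X Y s / C)) (at s)"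
  shows "filterlim t at_top at_top"
proof (rule filterlim_at_top_of_derivative_ge)
  show "(t has_real_derivative sqrt (N s / - C)) (at s)" for s
    using assms(2)[of s] by (simp add: N_def)
  show "sqrt (N 0 / - C) \<le> sqrt (N s / - C)" if "s \<ge> 0" for s
    using monoD[OF N_mono that] \<open>C < 0\<close> by (simp add: divide_right_mono_neg)
  show "0 < sqrt (N 0 / - C)"
    using N_pos[of 0] \<open>C < 0\<close> by (simp add: divide_pos_neg)
qed

text \<open>L'Hopital's rule gives \<open>W i s / t s\<close> a limit proportional to
  \<open>1 / d i\<close>. The factor \<open>d i\<close> in \<open>k\<close> cancels it, so the
  coefficient of \<open>lam i\<close> is the same for every factor, whence the homothety.\<close>

lemma warping_limit:
  assumes "C < 0" and assoc: "associated_warping r d lam C X Y t g"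
    and i: "i \<in> {1..r}" and pos: "0 < d i" "0 < lam i"
    and l: "0 < l" "(N \<longlongrightarrow> l) at_top"
  shows "((\<lambda>\<tau>. (g i \<tau>)\<^sup>2 / \<tau>) \<longlongrightarrow> 2 * sqrt (l / - C) * lam i) at_top"
proof -
  have t_deriv: "(t has_real_derivative sqrt (N s / - C)) (at s)" for s
    using assoc by (simp add: associated_warping_def N_def)
  have t_lim: "filterlim t at_top at_top"
    using assoc by (intro arclength_filterlim[OF \<open>C < 0\<close>]) (simp add: associated_warping_def)
  define k where "k = real (d i) * lam i / - C"
  have g_eq: "(g i (t s))\<^sup>2 = k * W i s" for s
  proof -
    have "g i (t s) = sqrt (N s / - C) * sqrt (real (d i) * lam i) / Y i s"
      using assoc i by (simp add: associated_warping_def N_def)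
    moreover have "0 \<le> N s / - C"
      using N_pos[of s] \<open>C < 0\<close> by (intro divide_nonneg_pos) auto
    ultimately have "(g i (t s))\<^sup>2 = (N s / - C) * (real (d i) * lam i) / (Y i s)\<^sup>2"
      using pos by (simp add: power_mult_distrib power_divide del: divide_minus_right)
    then show ?thesis
      by (simp add: k_def W_def)
  qed
  have "((\<lambda>s. W i s / t s) \<longlongrightarrow>
      2 * (l / sqrt (real (d i))) / sqrt (real (d i)) / sqrt (l / - C)) at_top"
  proof (rule lhospital_at_top_at_top[OF t_lim])
    show "\<forall>\<^sub>F s in at_top. sqrt (N s / - C) \<noteq> 0"
      using N_pos \<open>C < 0\<close> by (auto simp: less_imp_neq[symmetric])
    show "((\<lambda>s. 2 * (X i s * W i s) / sqrt (real (d i)) / sqrt (N s / - C)) \<longlongrightarrow>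
        2 * (l / sqrt (real (d i))) / sqrt (real (d i)) / sqrt (l / - C)) at_top"
      using l pos \<open>C < 0\<close> by (intro tendsto_intros XW_limit[OF i]) auto
  qed (simp_all add: W_deriv[OF i] t_deriv del: divide_minus_right)
  then have "((\<lambda>s. k * (W i s / t s)) \<longlongrightarrow>
      k * (2 * (l / sqrt (real (d i))) / sqrt (real (d i)) / sqrt (l / - C))) at_top"
    by (rule tendsto_mult_left)
  moreover have "k * (2 * (l / sqrt (real (d i))) / sqrt (real (d i)) / sqrt (l / - C)) =
      2 * sqrt (l / - C) * lam i"
  proof -
    have "k * (2 * (l / sqrt (real (d i))) / sqrt (real (d i)) / sqrt (l / - C)) =
        2 * lam i * ((l / - C) / sqrt (l / - C))"
      using pos by (simp add: k_def)
    also have "(l / - C) / sqrt (l / - C) = sqrt (l / - C)"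
      using l \<open>C < 0\<close> by (intro real_div_sqrt divide_nonneg_pos) auto
    finally show ?thesis
      by simp
  qed
  ultimately have "((\<lambda>s. (g i (t s))\<^sup>2 / t s) \<longlongrightarrow> 2 * sqrt (l / - C) * lam i) at_top"
    by (simp add: g_eq)
  then show ?thesis
    by (intro tendsto_at_top_of_reparametrization[OF _ t_lim, where f = "\<lambda>\<tau>. (g i \<tau>)\<^sup>2 / \<tau>"])
       (rule DERIV_isCont[OF t_deriv])
qed

end

section \<open>The limiting metric on the product\<close>

theorem theorem3p10:
  fixes r :: nat
    and M :: "nat \<Rightarrow> 'a riemannian"
    and d :: "nat \<Rightarrow> nat"
    and lam :: "nat \<Rightarrow> real"
    and X Y :: "nat \<Rightarrow> real \<Rightarrow> real"
    and C :: real
    and t :: "real \<Rightarrow> real"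
    and g :: "nat \<Rightarrow> real \<Rightarrow> real"
  assumes "r \<ge> 1"
    and "\<And>i. i \<in> {1..r} \<Longrightarrow> d i = mdim (M i)"
    and "d 1 > 1"
    and "round_unit_sphere (d 1) (M 1)"
    and "lam 1 = real (d 1) - 1"
    and "\<And>i. i \<in> {2..r} \<Longrightarrow> compact_einstein (M i) (lam i) \<and> lam i > 0"
    and "admissible_trajectory r d X Y"
    and "C < 0"
    and "associated_warping r d lam C X Y t g"
  shows "\<exists>c :: nat \<Rightarrow> real.
     (\<forall>i\<in>{1..r}. c i > 0) \<and>
     (\<exists>\<kappa>>0. \<forall>ch p v w. product_chart_at r M ch p \<longrightarrow>
        product_metric r M c ch p v w = \<kappa> * product_metric r M lam ch p v w) \<and>
     (\<forall>i\<in>{1..r}. ((\<lambda>\<tau>. (g i \<tau>)\<^sup>2 / \<tau>) \<longlongrightarrow> c i) at_top) \<and>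
     (\<forall>ch p V W. product_chart_at r M ch p \<longrightarrow>
        ((\<lambda>\<tau>. (warped_metric r M g ch \<tau> p V W - fst V * fst W) / \<tau>)
           \<longlongrightarrow> product_metric r M c ch p (snd V) (snd W)) at_top)"
proof -
  interpret soliton_trajectory r d X Y
    using \<open>admissible_trajectory r d X Y\<close>
    by unfold_locales (auto simp: admissible_trajectory_def)
  obtain l where l: "0 < l" "(N \<longlongrightarrow> l) at_top"
    using N_limit .
  \<comment> \<open>The homothety factor; it depends only on \<open>C\<close> and the limit of
    \<open>N\<close>.\<close>
  define \<kappa> where "\<kappa> = 2 * sqrt (l / - C)"
  have \<kappa>: "0 < \<kappa>"
    using l \<open>C < 0\<close> by (simp add: \<kappa>_def divide_pos_neg)
  \<comment> \<open>For the sphere this follows from \<open>d 1 > 1\<close>; for the other factors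
    \<open>compact_einstein\<close> includes positive dimension.\<close>
  have pos: "0 < d i \<and> 0 < lam i" if "i \<in> {1..r}" for i
  proof (cases "i = 1")
    case True
    then show ?thesis
      using \<open>d 1 > 1\<close> \<open>lam 1 = real (d 1) - 1\<close> by simp
  next
    case False
    then show ?thesis
      using assms(2)[OF that] assms(6)[of i] that by (auto simp: compact_einstein_def)
  qed
  have g_lim: "((\<lambda>\<tau>. (g i \<tau>)\<^sup>2 / \<tau>) \<longlongrightarrow> \<kappa> * lam i) at_top" if "i \<in> {1..r}" for i
    unfolding \<kappa>_def using pos[OF that] l
    by (intro warping_limit[OF \<open>C < 0\<close> \<open>associated_warping r d lam C X Y t g\<close> that]) auto
  have warped_lim: "((\<lambda>\<tau>. (warped_metric r M g ch \<tau> p V W - fst V * fst W) / \<tau>) \<longlongrightarrow>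
      product_metric r M (\<lambda>i. \<kappa> * lam i) ch p (snd V) (snd W)) at_top" for ch p V W
  proof -
    \<comment> \<open>Without the \<open>dt\<close> part a finite sum remains, whose only dependence
      on \<open>\<tau>\<close> is through the quotients treated in \<open>g_lim\<close>.\<close>
    have eq: "(warped_metric r M g ch \<tau> p V W - fst V * fst W) / \<tau> =
        (\<Sum>i=1..r. (g i \<tau>)\<^sup>2 / \<tau> * metric_form (M i) (ch i) (p i) (snd V i) (snd W i))" for \<tau>
      by (simp add: warped_metric_def product_metric_def sum_divide_distrib)
    show ?thesis
      unfolding eq product_metric_def by (intro tendsto_intros g_lim)
  qed
  show ?thesis
  proof (intro exI[of _ "\<lambda>i. \<kappa> * lam i"] conjI)
    show "\<exists>\<kappa>'>0. \<forall>ch p v w. product_chart_at r M ch p \<longrightarrow>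
        product_metric r M (\<lambda>i. \<kappa> * lam i) ch p v w = \<kappa>' * product_metric r M lam ch p v w"
      using \<kappa>
      by (intro exI[of _ \<kappa>]) (simp add: product_metric_def sum_distrib_left mult.assoc)
  qed (use \<kappa> pos g_lim warped_lim in auto)
qed

end
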